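(* Let $p<q$ be primes, and consider the polynomial $I(\varGamma(\mathbb{Z}_{pq}),x)$. (1) If $p$ and $q$ are odd primes, then $I(\varGamma(\mathbb{Z}_{pq}),x)$ has exactly two real zeros, one in the interval $(-1,0)$ and another in $(-2,-1)$. (2) If $p=2$ and $q$ is an odd prime, then $I(\varGamma(\mathbb{Z}_{pq}),x)$ has exactly two real zeros, one in the interval $(-1,0)$ and another in $(-3,-2)$.
   Context: For a positive integer $n$, the zero divisor graph $\varGamma(\mathbb{Z}_n)$ is the simple undirected graph whose vertices are the non-zero zero divisors of the ring $\mathbb{Z}_n$ of integers modulo $n$ (non-zero $a$ such that $ab=0$ for some non-zero $b$), two distinct vertices $a,b$ being adjacent if and only if $ab=0$ in $\mathbb{Z}_n$. An independent set of a finite graph $G$ is a set of vertices no two of which are adjacent (the empty set included); $\alpha(G)$ is the maximum size of an independent set, and $s_k(G)$ is the number of independent sets of size $k$. The independence polynomial of $G$ is $I(G,x)=\sum_{k=0}^{\alpha(G)} s_k(G)x^k$. *)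

theory Defs
  imports
    "HOL-Number_Theory.Residues"
    "HOL-Computational_Algebra.Polynomial"
    "Graph_Theory.Pair_Digraph"
begin

definition nonzero_zero_divisors :: "('a, 'b) ring_scheme \<Rightarrow> 'a set" where
  "nonzero_zero_divisors R =
     {a \<in> carrier R - {\<zero>\<^bsub>R\<^esub>}. \<exists>b \<in> carrier R - {\<zero>\<^bsub>R\<^esub>}. a \<otimes>\<^bsub>R\<^esub> b = \<zero>\<^bsub>R\<^esub>}"

text \<open>
  As is usual in \<^verbatim>\<open>Graph_Theory\<close>, a simple undirected graph is represented by a symmetric
  loop-free digraph (locale \<^locale>\<open>pair_graph\<close>); an undirected edge between \<open>a\<close> and \<open>b\<close>
  corresponds to the two arcs \<open>(a, b)\<close> and \<open>(b, a)\<close>.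
\<close>

definition zero_divisor_graph :: "('a, 'b) ring_scheme \<Rightarrow> 'a pair_pre_digraph" where
  "zero_divisor_graph R =
     \<lparr> pverts = nonzero_zero_divisors R,
       parcs = {(a, b). a \<in> nonzero_zero_divisors R \<and> b \<in> nonzero_zero_divisors R \<and>
                        a \<noteq> b \<and> a \<otimes>\<^bsub>R\<^esub> b = \<zero>\<^bsub>R\<^esub>} \<rparr>"

lemma pair_graph_zero_divisor_graph:
  assumes "cring R" and "finite (carrier R)"
  shows "pair_graph (zero_divisor_graph R)"
proof -
  interpret cring R by fact
  let ?V = "nonzero_zero_divisors R"
  have V: "?V \<subseteq> carrier R"
    by (auto simp: nonzero_zero_divisors_def)
  then have fin: "finite ?V"
    using assms(2) finite_subset by blast
  have "finite (parcs (zero_divisor_graph R))"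
    by (rule finite_subset[of _ "?V \<times> ?V"]) (auto simp: zero_divisor_graph_def fin)
  moreover have "sym (parcs (zero_divisor_graph R))"
    using V by (auto simp: zero_divisor_graph_def sym_def m_comm subset_iff)
  ultimately show ?thesis
    using fin by unfold_locales (auto simp: zero_divisor_graph_def symmetric_def)
qed

definition independent_set :: "'a pair_pre_digraph \<Rightarrow> 'a set \<Rightarrow> bool" where
  "independent_set G S \<longleftrightarrow> S \<subseteq> pverts G \<and> (\<forall>a\<in>S. \<forall>b\<in>S. (a, b) \<notin> parcs G)"

definition independence_number :: "'a pair_pre_digraph \<Rightarrow> nat" where
  "independence_number G = Max {card S | S. independent_set G S}"

definition num_independent_sets :: "'a pair_pre_digraph \<Rightarrow> nat \<Rightarrow> nat" where
  "num_independent_sets G k = card {S. independent_set G S \<and> card S = k}"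

definition independence_poly :: "'a pair_pre_digraph \<Rightarrow> real poly" where
  "independence_poly G =
     (\<Sum>k = 0..independence_number G. monom (real (num_independent_sets G k)) k)"

text \<open>
  \<^const>\<open>residue_ring\<close> is the ring of integers modulo \<open>n\<close> for \<open>n > 1\<close> only; for \<open>n = 1\<close> it has
  carrier \<open>{0}\<close> but unit \<open>1\<close>, which does not matter here since the unit is not used and the graph
  is empty.
\<close>

abbreviation zero_divisor_graph_mod :: "nat \<Rightarrow> int pair_pre_digraph" where
  "zero_divisor_graph_mod n \<equiv> zero_divisor_graph (residue_ring (int n))"

end

theory Submission
  imports Defs
begin

text \<open>
  The vertices of the zero divisor graph of \<open>\<int>\<^sub>p\<^sub>q\<close> are the multiples of \<open>p\<close> and the multiples of
  \<open>q\<close>, and the graph is the complete bipartite graph between these two classes, of sizes \<open>q - 1\<close>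
  and \<open>p - 1\<close>. An independent set is a subset of one of the classes, so the independence polynomial
  is \<open>(1 + x)^(q - 1) + (1 + x)^(p - 1) - 1\<close>. In \<open>y = 1 + x\<close> it is increasing for \<open>y \<ge> 0\<close>, which
  gives one zero in \<open>(0, 1)\<close>. For odd \<open>p\<close> it is even in \<open>y\<close>; for \<open>p = 2\<close> the
  negative zeros \<open>y = - t\<close> are those of \<open>t (t^(q - 2) - 1) = 1\<close>, whose left-hand side is negative on
  \<open>(0, 1)\<close> and increasing for \<open>t \<ge> 1\<close>.
\<close>

text \<open>Expand the product of \<open>x + 1\<close> over \<open>A\<close>: a subset
  \<open>S\<close> records the factors from which \<open>x\<close> is taken.\<close>

lemma sum_Pow_power_card:
  fixes x :: "'a :: comm_semiring_1"
  assumes "finite A"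
  shows "(\<Sum>S\<in>Pow A. x ^ card S) = (1 + x) ^ card A"
  using prod_add[OF assms, of "\<lambda>_. x" "\<lambda>_. 1"] by (simp add: add.commute)

text \<open>Grouping independent sets by size loses none, since no size exceeds
  \<open>independence_number G\<close>. Evaluation thus avoids counting the sets of each
  size.\<close>

lemma poly_independence_poly:
  assumes "finite (pverts G)"
  shows "poly (independence_poly G) x = (\<Sum>S | independent_set G S. x ^ card S)"
proof -
  let ?I = "{S. independent_set G S}"
  have fin: "finite ?I"
    by (rule finite_subset[of _ "Pow (pverts G)"]) (auto simp: independent_set_def assms)
  have le: "card S \<le> independence_number G" if "independent_set G S" for S
    unfolding independence_number_def using that fin by (intro Max_ge) auto
  have "poly (independence_poly G) x
      = (\<Sum>k = 0..independence_number G. \<Sum>S\<in>{S\<in>?I. card S = k}. x ^ card S)"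
    by (simp add: independence_poly_def poly_sum poly_monom num_independent_sets_def)
  also have "\<dots> = (\<Sum>S\<in>?I. x ^ card S)"
    using le by (intro sum.group fin) auto
  finally show ?thesis .
qed

text \<open>An independent set cannot meet both sides, so it is a subset of \<open>A\<close> or of
  \<open>B\<close>. Only the empty set is both, whence the \<open>- 1\<close>.\<close>

lemma poly_independence_poly_complete_bipartite:
  assumes "finite A" "finite B" "A \<inter> B = {}"
    and V: "pverts G = A \<union> B" and E: "parcs G = A \<times> B \<union> B \<times> A"
  shows "poly (independence_poly G) x = (1 + x) ^ card A + (1 + x) ^ card B - 1"
proof -
  have "{S. independent_set G S} = Pow A \<union> Pow B"
    using assms(3) unfolding independent_set_def V E by blast
  moreover have "Pow A \<inter> Pow B = {{}}"
    using assms(3) by blast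
  ultimately show ?thesis
    using assms(1,2) by (simp add: poly_independence_poly V sum_Un sum_Pow_power_card)
qed

lemma card_positive_multiples_below:
  assumes "p > 0"
  shows "card {a \<in> {1..int (p * q) - 1}. int p dvd a} = q - 1"
proof -
  have "{a \<in> {1..int (p * q) - 1}. int p dvd a} = (\<lambda>k. int p * k) ` {1..int q - 1}"
    (is "?L = ?R")
  proof
    show "?L \<subseteq> ?R"
    proof
      fix a assume a: "a \<in> ?L"
      then obtain k where k: "a = int p * k" by (auto elim: dvdE)
      have "k \<ge> 1" "k < int q"
        using a assms by (auto simp: k zero_less_mult_iff int_one_le_iff_zero_less)
      then show "a \<in> ?R" by (auto simp: k)
    qed
    show "?R \<subseteq> ?L"
    proof
      fix a assume "a \<in> ?R"
      then obtain k where k: "a = int p * k" "k \<in> {1..int q - 1}" by (rule imageE)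
      then have "0 < a" "a < int p * int q"
        using assms by auto
      then show "a \<in> ?L" by (auto simp: k)
    qed
  qed
  moreover have "inj_on (\<lambda>k. int p * k) {1..int q - 1}"
    using assms by (auto simp: inj_on_def)
  ultimately show ?thesis
    by (simp add: card_image)
qed

lemma poly_independence_poly_zero_divisor_graph_mod:
  assumes p: "prime p" and q: "prime q" and "p \<noteq> q"
  shows "poly (independence_poly (zero_divisor_graph_mod (p * q))) x
           = (1 + x) ^ (q - 1) + (1 + x) ^ (p - 1) - 1"
proof -
  define N where "N = int (p * q)"
  define A where "A = {a \<in> {1..N - 1}. int p dvd a}"
  define B where "B = {a \<in> {1..N - 1}. int q dvd a}"
  let ?R = "residue_ring N"
  have pp: "prime (int p)" and pq: "prime (int q)"
    using p q by auto
  have cop: "coprime (int p) (int q)"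
    using assms by (simp add: primes_coprime)
  have p1: "int p > 1" and q1: "int q > 1"
    using p q prime_gt_1_nat by auto
  have N: "N = int p * int q"
    by (simp add: N_def)
  have pN: "int p < N" and qN: "int q < N"
    using p1 q1 by (auto simp: N)
  \<comment> \<open>Coprimality splits divisibility by \<open>N\<close>, so that each prime can be
    treated separately.\<close>
  have dvdN: "N dvd c \<longleftrightarrow> int p dvd c \<and> int q dvd c" for c
    unfolding N using cop divides_mult by (auto dest: dvd_mult_left dvd_mult_right)
  have not_both: "\<not> (int p dvd a \<and> int q dvd a)" if "a \<in> {1..N - 1}" for a
    using that zdvd_imp_le[of N a] by (auto simp flip: dvdN)
  have carrier: "carrier ?R - {\<zero>\<^bsub>?R\<^esub>} = {1..N - 1}"
    by (auto simp: residue_ring_def)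
  have mult: "a \<otimes>\<^bsub>?R\<^esub> b = \<zero>\<^bsub>?R\<^esub> \<longleftrightarrow> N dvd a * b" for a b
    by (auto simp: residue_ring_def dvd_eq_mod_eq_0)
  have V: "nonzero_zero_divisors ?R = A \<union> B"
  proof -
    have "(\<exists>b\<in>{1..N - 1}. N dvd a * b) \<longleftrightarrow> int p dvd a \<or> int q dvd a"
      if a: "a \<in> {1..N - 1}" for a
    proof
      assume "\<exists>b\<in>{1..N - 1}. N dvd a * b"
      \<comment> \<open>If neither prime divided \<open>a\<close>, both would divide
        \<open>b\<close>, which \<open>not_both\<close> excludes.\<close>
      then show "int p dvd a \<or> int q dvd a"
        using not_both by (auto simp: dvdN prime_dvd_mult_iff[OF pp] prime_dvd_mult_iff[OF pq])
    next
      assume "int p dvd a \<or> int q dvd a"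
      then show "\<exists>b\<in>{1..N - 1}. N dvd a * b"
      proof
        assume "int p dvd a"
        then show ?thesis
          \<comment> \<open>The other prime annihilates \<open>a\<close>.\<close>
          using q1 qN by (intro bexI[of _ "int q"]) (auto simp: dvdN)
      next
        assume "int q dvd a"
        then show ?thesis
          using p1 pN by (intro bexI[of _ "int p"]) (auto simp: dvdN)
      qed
    qed
    then show ?thesis
      unfolding nonzero_zero_divisors_def carrier mult A_def B_def by blast
  qed
  have disj: "A \<inter> B = {}"
    using not_both by (auto simp: A_def B_def)
  \<comment> \<open>Each vertex is divisible by exactly one of the primes, so a product vanishes
    only across the classes.\<close>
  have "N dvd a * b \<longleftrightarrow> (a \<in> A \<and> b \<in> B \<or> a \<in> B \<and> b \<in> A)" if "a \<in> A \<union> B" "b \<in> A \<union> B" for a b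
    using that not_both
    unfolding dvdN prime_dvd_mult_iff[OF pp] prime_dvd_mult_iff[OF pq] A_def B_def by blast
  then have E: "parcs (zero_divisor_graph ?R) = A \<times> B \<union> B \<times> A"
    using disj unfolding zero_divisor_graph_def V mult by auto
  have "A \<subseteq> {1..N - 1}" "B \<subseteq> {1..N - 1}"
    by (auto simp: A_def B_def)
  then have "finite A" "finite B"
    by (auto dest: finite_subset)
  moreover have "card A = q - 1" "card B = p - 1"
    using card_positive_multiples_below[of p q] card_positive_multiples_below[of q p] p q
    by (auto simp: A_def B_def N_def prime_gt_0_nat mult.commute)
  moreover have "pverts (zero_divisor_graph ?R) = A \<union> B"
    by (simp add: zero_divisor_graph_def V)
  ultimately show ?thesis
    using poly_independence_poly_complete_bipartite[OF _ _ disj _ E, of x]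
    by (simp add: N_def)
qed

lemma ex1_nonneg_zero_power_add_power:
  fixes m n :: nat
  assumes "m > 0" "n > 0"
  obtains r :: real where "0 < r" "r < 1"
    "\<And>y. y \<ge> 0 \<Longrightarrow> y ^ n + y ^ m - 1 = 0 \<longleftrightarrow> y = r"
proof -
  let ?f = "\<lambda>y::real. y ^ n + y ^ m - 1"
  have mono: "?f y < ?f z" if "0 \<le> y" "y < z" for y z
    using power_strict_mono[of y z m] power_strict_mono[of y z n] that assms by simp
  have "continuous_on {0..1} ?f"
    by (intro continuous_intros)
  \<comment> \<open>The values at the ends are \<open>-1\<close> (the exponents being positive) and
    \<open>1\<close>.\<close>
  then have "\<exists>r\<ge>0. r \<le> 1 \<and> ?f r = 0"
    using assms by (intro IVT'[of ?f 0 0 1]) (auto simp: power_0_left)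
  then obtain r where r: "0 \<le> r" "r \<le> 1" "?f r = 0"
    by blast
  have "r \<noteq> 0" "r \<noteq> 1"
    using r(3) assms by (auto simp: power_0_left)
  show thesis
  proof
    show "0 < r" "r < 1"
      using r(1,2) \<open>r \<noteq> 0\<close> \<open>r \<noteq> 1\<close> by linarith+
    show "?f y = 0 \<longleftrightarrow> y = r" if "y \<ge> 0" for y
      using mono[of y r] mono[of r y] r that by (cases y r rule: linorder_cases) auto
  qed
qed

text \<open>Serves the case \<open>p = 2\<close>, with \<open>n = q - 1\<close> even and
  \<open>y = - (1 + x)\<close>.\<close>

lemma ex1_pos_zero_power_diff_linear:
  fixes n :: nat
  assumes "n \<ge> 2"
  obtains t :: real where "1 < t" "t < 2"
    "\<And>y. y > 0 \<Longrightarrow> y ^ n - y - 1 = 0 \<longleftrightarrow> y = t"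
proof -
  let ?f = "\<lambda>y::real. y ^ n - y - 1"
  obtain k where n: "n = Suc k" and k: "k > 0"
    using assms by (cases n) auto
  \<comment> \<open>In this form monotonicity for \<open>y \<ge> 1\<close> is visible: both factors
    are nonnegative and strictly increasing there.\<close>
  have f: "?f y = y * (y ^ k - 1) - 1" for y
    by (simp add: n algebra_simps)
  have mono: "?f y < ?f z" if "1 \<le> y" "y < z" for y z
  proof -
    have "y ^ k < z ^ k"
      using that k by (intro power_strict_mono) auto
    moreover have "1 \<le> y ^ k"
      using that by simp
    ultimately have "y * (y ^ k - 1) < z * (z ^ k - 1)"
      using that by (intro mult_strict_mono') auto
    then show ?thesis by (simp only: f)
  qed
  have neg: "?f y < 0" if "0 < y" "y \<le> 1" for y
    using that power_le_one[of y n] by simp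
  \<comment> \<open>At \<open>2\<close> the value is at least \<open>4 - 2 - 1\<close>, while at
    \<open>1\<close> it is \<open>-1\<close>.\<close>
  have "(2::real) ^ 2 \<le> 2 ^ n"
    using assms by (intro power_increasing) auto
  then have f2: "?f 2 > 0" by simp
  have "continuous_on {1..2} ?f"
    by (intro continuous_intros)
  then have "\<exists>t\<ge>1. t \<le> 2 \<and> ?f t = 0"
    using f2 by (intro IVT'[of ?f 1 0 2]) auto
  then obtain t where t: "1 \<le> t" "t \<le> 2" "?f t = 0"
    by blast
  show thesis
  proof
    show "1 < t" "t < 2"
      using t f2 neg[of 1] by (auto simp: less_le)
    show "?f y = 0 \<longleftrightarrow> y = t" if "y > 0" for y
      using mono[of y t] mono[of t y] neg[of y] t that
      by (cases y t rule: linorder_cases; cases "y \<le> 1") auto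
  qed
qed

theorem theorem2p3:
  fixes p q :: nat
  assumes "prime p" and "prime q" and "p < q"
  shows "(odd p \<and> odd q \<longrightarrow>
           (\<exists>a b. {x :: real. poly (independence_poly (zero_divisor_graph_mod (p * q))) x = 0} = {a, b}
              \<and> a \<in> {-1<..<0} \<and> b \<in> {-2<..<-1})) \<and>
         (p = 2 \<and> odd q \<longrightarrow>
           (\<exists>a b. {x :: real. poly (independence_poly (zero_divisor_graph_mod (p * q))) x = 0} = {a, b}
              \<and> a \<in> {-1<..<0} \<and> b \<in> {-3<..<-2}))"
proof -
  let ?P = "\<lambda>x. poly (independence_poly (zero_divisor_graph_mod (p * q))) x"
  have P: "?P x = (1 + x) ^ (q - 1) + (1 + x) ^ (p - 1) - 1" for x
    using poly_independence_poly_zero_divisor_graph_mod assms by auto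
  have p2: "p \<ge> 2"
    using assms(1) by (rule prime_ge_2_nat)
  obtain r :: real where r: "0 < r" "r < 1"
    and pos: "\<And>y. y \<ge> 0 \<Longrightarrow> y ^ (q - 1) + y ^ (p - 1) - 1 = 0 \<longleftrightarrow> y = r"
    using ex1_nonneg_zero_power_add_power[of "p - 1" "q - 1"] p2 assms(3) by auto
  \<comment> \<open>The zero \<open>r\<close> of \<open>y = 1 + x\<close> is common to both cases;
    only the unique negative zero \<open>- t\<close> remains to be supplied.\<close>
  have roots: "{x. ?P x = 0} = {r - 1, - t - 1}"
    if "t > 0" and neg: "\<And>y. y > 0 \<Longrightarrow> (- y) ^ (q - 1) + (- y) ^ (p - 1) - 1 = 0 \<longleftrightarrow> y = t"
    for t
  proof -
    have "?P x = 0 \<longleftrightarrow> x = r - 1 \<or> x = - t - 1" for x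
    proof (cases "1 + x \<ge> 0")
      case True
      then show ?thesis
        using pos[of "1 + x"] \<open>t > 0\<close> unfolding P by auto
    next
      case False
      have "- (- 1 - x) = 1 + x" by simp
      then have "?P x = 0 \<longleftrightarrow> - 1 - x = t"
        using neg[of "- 1 - x"] False unfolding P by (simp only:)
      then show ?thesis
        using False r by auto
    qed
    then show ?thesis by auto
  qed
  have "\<exists>a b. {x. ?P x = 0} = {a, b} \<and> a \<in> {-1<..<0} \<and> b \<in> {-2<..<-1}"
    if "odd p" "odd q"
  proof -
    \<comment> \<open>Both exponents are even, so the sign of \<open>y\<close> disappears and
      \<open>t = r\<close> works.\<close>
    have "{x. ?P x = 0} = {r - 1, - r - 1}"
      using that pos r by (intro roots) auto
    then show ?thesis
      using r by (intro exI[of _ "r - 1"] exI[of _ "- r - 1"]) auto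
  qed
  moreover have "\<exists>a b. {x. ?P x = 0} = {a, b} \<and> a \<in> {-1<..<0} \<and> b \<in> {-3<..<-2}"
    if "p = 2" "odd q"
  proof -
    have "q - 1 \<ge> 2"
      using assms(3) that by simp
    then obtain t :: real where t: "1 < t" "t < 2"
      and t0: "\<And>y. y > 0 \<Longrightarrow> y ^ (q - 1) - y - 1 = 0 \<longleftrightarrow> y = t"
      using ex1_pos_zero_power_diff_linear by blast
    \<comment> \<open>Here \<open>q - 1\<close> is even and \<open>p - 1 = 1\<close>, so only the
      linear term changes sign.\<close>
    have "{x. ?P x = 0} = {r - 1, - t - 1}"
      using that t0 t by (intro roots) auto
    then show ?thesis
      using r t by (intro exI[of _ "r - 1"] exI[of _ "- t - 1"]) auto
  qed
  ultimately show ?thesis by blast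
qed

end
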